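(* Let $(L,\vee,\wedge)$ be a lattice. Then the following statements are equivalent: (i) $L$ is a chain (i.e. any two elements of $L$ are comparable); (ii) the set of all integral operators on $L$ equals the set of all maps $P:L\to L$ that are both isotone and idempotent.
   Context: Let $(L,\vee,\wedge)$ be a lattice with its induced partial order $\leq$. A map $P:L\to L$ is an integral operator if for all $x,y\in L$: (1) $P(x\vee y)=P(x)\vee P(y)$, and (2) $P(x)\wedge P(y)=P(P(x)\wedge y)\vee P(x\wedge P(y))$. $P$ is isotone if $x\leq y$ implies $P(x)\leq P(y)$, and idempotent if $P(P(x))=P(x)$ for all $x\in L$. *)

theory Defs
  imports Main
begin

definition integral_operator :: "('a::lattice \<Rightarrow> 'a) \<Rightarrow> bool" where
  "integral_operator P \<longleftrightarrow>
     (\<forall>x y. P (sup x y) = sup (P x) (P y)) \<and>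
     (\<forall>x y. inf (P x) (P y) = sup (P (inf (P x) y)) (P (inf x (P y))))"

definition idempotent_map :: "('a \<Rightarrow> 'a) \<Rightarrow> bool" where
  "idempotent_map P \<longleftrightarrow> (\<forall>x. P (P x) = P x)"

end

theory Submission
  imports Defs
begin

text \<open>
  An integral operator is isotone because it preserves joins, and it is idempotent on every lattice:
  axiom (2) at \<open>y = P x\<close> gives \<open>P (P x) \<le> P x\<close>, and at \<open>y = x\<close> it gives \<open>P x = P (P x \<sqinter> x)\<close>, which is
  below \<open>P (P x)\<close>. So the set of integral operators is always contained in the set of isotone
  idempotent maps, and the theorem is about the converse inclusion.

  On a chain the converse holds: isotone maps preserve the join of two comparable elements, and the
  remaining identity follows by comparing \<open>x\<close> with \<open>P y\<close> (lemma \<open>integral_identity_ordered\<close>). If, on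
  the other hand, \<open>a\<close> and \<open>b\<close> are incomparable, then the two-valued map that sends the filter
  generated by \<open>a \<squnion> b\<close> to \<open>a \<squnion> b\<close> and everything else to \<open>a \<sqinter> b\<close> is isotone and idempotent, but
  \<open>a\<close> and \<open>b\<close> both lie outside the filter while their join lies in it, so joins are not preserved.
\<close>

lemma integral_operator_mono:
  assumes "integral_operator P"
  shows "mono P"
proof
  fix x y :: 'a
  assume "x \<le> y"
  then have "P y = sup (P x) (P y)"
    using assms by (metis integral_operator_def sup.absorb2)
  then show "P x \<le> P y" by (metis sup.cobounded1)
qed

lemma integral_operator_idempotent:
  assumes "integral_operator P"
  shows "idempotent_map P"
  unfolding idempotent_map_def
proof
  fix x
  have int: "inf (P x) (P y) = sup (P (inf (P x) y)) (P (inf x (P y)))" for y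
    using assms by (simp add: integral_operator_def)
  show "P (P x) = P x"
  proof (rule antisym)
    have "P (P x) \<le> inf (P x) (P (P x))"
      using int[of "P x"] by simp
    then show "P (P x) \<le> P x" by simp
    have "P x = P (inf (P x) x)"
      using int[of x] by (simp add: inf_commute)
    also have "\<dots> \<le> P (P x)"
      by (intro monoD[OF integral_operator_mono[OF assms]]) simp
    finally show "P x \<le> P (P x)" .
  qed
qed

text \<open>
  Both terms on the right are at most \<open>P x\<close>. If \<open>x \<le> P y\<close>, the second one is \<open>P x\<close>; if
  \<open>P y \<le> x\<close>, then \<open>P x \<le> P y \<le> x \<le> y\<close>, so the first one is \<open>P (P x) = P x\<close>.
\<close>
lemma integral_identity_ordered:
  fixes P :: "'a::lattice \<Rightarrow> 'a"
  assumes "mono P" and "idempotent_map P" and "x \<le> y" and "x \<le> P y \<or> P y \<le> x"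
  shows "inf (P x) (P y) = sup (P (inf (P x) y)) (P (inf x (P y)))"
proof -
  have idem: "P (P x) = P x"
    using assms(2) by (simp add: idempotent_map_def)
  have le: "P x \<le> P y"
    using assms(1,3) by (rule monoD)
  have fst_le: "P (inf (P x) y) \<le> P x"
    using monoD[OF assms(1), of "inf (P x) y" "P x"] idem by simp
  have snd_le: "P (inf x (P y)) \<le> P x"
    by (rule monoD[OF assms(1)]) simp
  from assms(4) have "sup (P (inf (P x) y)) (P (inf x (P y))) = P x"
  proof
    assume "x \<le> P y"
    then show ?thesis using fst_le by (simp add: inf_absorb1 sup_absorb2)
  next
    assume "P y \<le> x"
    then have "P x \<le> y" using le assms(3) by (meson order_trans)
    then show ?thesis using snd_le idem by (simp add: inf_absorb1 sup_absorb1)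
  qed
  then show ?thesis using le by (simp add: inf_absorb1)
qed

lemma integral_operator_if_chain:
  fixes P :: "'a::lattice \<Rightarrow> 'a"
  assumes chain: "\<And>x y :: 'a. x \<le> y \<or> y \<le> x"
    and "mono P" and "idempotent_map P"
  shows "integral_operator P"
  unfolding integral_operator_def
proof (intro conjI allI)
  fix x y :: 'a
  show "P (sup x y) = sup (P x) (P y)"
    using chain[of x y] monoD[OF assms(2)] by (metis sup.absorb1 sup.absorb2)
  from chain[of x y] show "inf (P x) (P y) = sup (P (inf (P x) y)) (P (inf x (P y)))"
  proof
    assume "x \<le> y"
    then show ?thesis by (rule integral_identity_ordered[OF assms(2,3) _ chain])
  next
    assume "y \<le> x"
    \<comment> \<open>The identity is symmetric in \<open>x\<close> and \<open>y\<close>.\<close>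
    then have "inf (P y) (P x) = sup (P (inf (P y) x)) (P (inf y (P x)))"
      by (rule integral_identity_ordered[OF assms(2,3) _ chain])
    then show ?thesis by (simp add: inf_commute sup_commute)
  qed
qed

lemma two_valued_mono_idempotent:
  fixes c d :: "'a::lattice"
  assumes "d \<le> c"
  defines "P \<equiv> \<lambda>z. if c \<le> z then c else d"
  shows "mono P" and "idempotent_map P"
  using assms(1) by (auto simp: P_def mono_def idempotent_map_def intro: order_trans)

lemma comparable_if_two_valued_integral:
  fixes a b :: "'a::lattice"
  assumes "integral_operator (\<lambda>z. if sup a b \<le> z then sup a b else inf a b)"
  shows "a \<le> b \<or> b \<le> a"
proof (rule ccontr)
  assume incomparable: "\<not> (a \<le> b \<or> b \<le> a)"
  let ?P = "\<lambda>z. if sup a b \<le> z then sup a b else inf a b"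
  have "?P (sup a b) = sup (?P a) (?P b)"
    using assms unfolding integral_operator_def by blast
  then have "sup a b = inf a b"
    using incomparable by simp
  then have "a \<le> b" by (metis inf.cobounded2 order_trans sup.cobounded1)
  then show False using incomparable by simp
qed

theorem theorem2p23:
  shows "(\<forall>x y :: 'a::lattice. x \<le> y \<or> y \<le> x) \<longleftrightarrow>
    {P :: 'a \<Rightarrow> 'a. integral_operator P} = {P. mono P \<and> idempotent_map P}"
proof
  assume "\<forall>x y :: 'a. x \<le> y \<or> y \<le> x"
  then show "{P :: 'a \<Rightarrow> 'a. integral_operator P} = {P. mono P \<and> idempotent_map P}"
    using integral_operator_mono integral_operator_idempotent integral_operator_if_chain
    by blast
next
  assume eq: "{P :: 'a \<Rightarrow> 'a. integral_operator P} = {P. mono P \<and> idempotent_map P}"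
  show "\<forall>x y :: 'a. x \<le> y \<or> y \<le> x"
  proof (intro allI)
    fix a b :: 'a
    have "inf a b \<le> sup a b" by (rule le_infI1) simp
    from two_valued_mono_idempotent[OF this]
    have "integral_operator (\<lambda>z. if sup a b \<le> z then sup a b else inf a b)"
      using eq by blast
    then show "a \<le> b \<or> b \<le> a" by (rule comparable_if_two_valued_integral)
  qed
qed

end
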